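(* Let $n$ and $k$, $0\le k\le n$, be integers. The number $P_{(x_{12}x_{23})^n(x_{34})^k}(\beta=0)$ is equal to the number of $n$ up, $n$ down, $k$ up permutations in the symmetric group $\mathbb{S}_{2n+k+1}$, that is, the number of $\sigma\in\mathbb{S}_{2n+k+1}$ with $$\sigma(1)<\cdots<\sigma(n+1)>\sigma(n+2)>\cdots>\sigma(2n+1)<\sigma(2n+2)<\cdots<\sigma(2n+k+1).$$
   Context: For a monomial $M$ in commuting variables $x_{ij}$, $i<j$, over $\mathbb{Z}[\beta]$, a reduced polynomial of $M$ is obtained by repeatedly replacing (in any monomial) a product $x_{ij}x_{jk}$, $i<j<k$, by $x_{ik}x_{ij}+x_{jk}x_{ik}+\beta x_{ik}$, until no monomial contains such a product. $P_M(\beta)$ denotes the value of the reduced polynomial at $x_{ij}=1$ for all $i<j$ (the replacements are applied successively starting from the leftmost variables $x_{12}^{m_1}x_{23}$). *)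

theory Defs
  imports
    "HOL-Library.Poly_Mapping"
    "HOL-Computational_Algebra.Polynomial"
    "HOL-Combinatorics.Permutations"
begin

text \<open>Polynomials in the commuting variables $x_{ij}$, with coefficients in $Z[\beta]$: a monomial
  maps the index pair $(i,j)$ to its exponent, and \<^typ>\<open>int poly\<close> is $Z[\beta]$.\<close>

type_synonym monomial = "(nat \<times> nat) \<Rightarrow>\<^sub>0 nat"
type_synonym xpoly = "monomial \<Rightarrow>\<^sub>0 int poly"

definition evar :: "nat \<Rightarrow> nat \<Rightarrow> monomial" where
  "evar i j = Poly_Mapping.single (i, j) 1"

definition X :: "nat \<Rightarrow> nat \<Rightarrow> xpoly" where
  "X i j = Poly_Mapping.single (evar i j) 1"

definition beta :: xpoly where
  "beta = Poly_Mapping.single 0 [:0, 1:]"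

definition eval_vars :: "(nat \<times> nat \<Rightarrow> int poly) \<Rightarrow> xpoly \<Rightarrow> int poly" where
  "eval_vars a p = (\<Sum>m\<in>Poly_Mapping.keys p. Poly_Mapping.lookup p m *
     (\<Prod>v\<in>Poly_Mapping.keys m. a v ^ Poly_Mapping.lookup m v))"

definition contains_product :: "monomial \<Rightarrow> nat \<Rightarrow> nat \<Rightarrow> nat \<Rightarrow> bool" where
  "contains_product m i j k \<longleftrightarrow> i < j \<and> j < k \<and>
     Poly_Mapping.lookup m (i, j) > 0 \<and> Poly_Mapping.lookup m (j, k) > 0"

definition is_reduced :: "xpoly \<Rightarrow> bool" where
  "is_reduced p \<longleftrightarrow> (\<forall>m\<in>Poly_Mapping.keys p. \<nexists>i j k. contains_product m i j k)"

text \<open>Leftmost means lexicographically least $(i,j,k)$ among the products $x_{ij} x_{jk}$ in the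
  monomial; so in $x_{12}^a x_{23}^b \cdots$ the product $x_{12} x_{23}$ is replaced as long as it
  is present.\<close>

definition leftmost_product :: "monomial \<Rightarrow> nat \<Rightarrow> nat \<Rightarrow> nat \<Rightarrow> bool" where
  "leftmost_product m i j k \<longleftrightarrow> contains_product m i j k \<and>
     (\<forall>i' j' k'. contains_product m i' j' k' \<longrightarrow>
        i < i' \<or> (i = i' \<and> (j < j' \<or> (j = j' \<and> k \<le> k'))))"

text \<open>One replacement: the term $c \, m$ of \<open>p\<close>, where $m = m' x_{ij} x_{jk}$, becomes
  $c \, m' (x_{ik} x_{ij} + x_{jk} x_{ik} + \beta x_{ik})$.\<close>

inductive reduction_step :: "xpoly \<Rightarrow> xpoly \<Rightarrow> bool" where
  "m \<in> Poly_Mapping.keys p \<Longrightarrow> leftmost_product m i j k \<Longrightarrow>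
   reduction_step p
     (p - Poly_Mapping.single m (Poly_Mapping.lookup p m)
        + Poly_Mapping.single (m - (evar i j + evar j k)) (Poly_Mapping.lookup p m)
          * (X i k * X i j + X j k * X i k + beta * X i k))"

definition is_reduced_polynomial_of :: "xpoly \<Rightarrow> xpoly \<Rightarrow> bool" where
  "is_reduced_polynomial_of M Q \<longleftrightarrow> reduction_step\<^sup>*\<^sup>* M Q \<and> is_reduced Q"

text \<open>A step may choose any nonreduced monomial, but the replacement made in it is forced. Hence
  the reduced polynomial exists and does not depend on the order in which monomials are treated.\<close>

definition reduced_polynomial :: "xpoly \<Rightarrow> xpoly" where
  "reduced_polynomial M = (THE Q. is_reduced_polynomial_of M Q)"

text \<open>$P_M(\beta)$, as a polynomial in $\beta$.\<close>

definition P :: "xpoly \<Rightarrow> int poly" where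
  "P M = eval_vars (\<lambda>_. 1) (reduced_polynomial M)"

end

theory Submission
  imports Defs
begin

text \<open>
  The proof computes both sides in closed form. Leftmost rewriting is deterministic on monomials,
  and every replacement lowers a weight, so a reduced polynomial exists and is unique
  (\<open>reduced_polynomial_unique_existence\<close>). Uniqueness holds because the reduced polynomial is
  obtained by iterating an additive operator that rewrites all terms at once: the result of
  sufficiently many rounds does not change along a reduction step.

  At \<open>\<beta> = 0\<close> a replacement turns one monomial into two. Hence the number of terms of the
  reduced polynomial of \<open>x\<^sub>1\<^sub>2\<^sup>a x\<^sub>2\<^sub>3\<^sup>b x\<^sub>1\<^sub>3\<^sup>c x\<^sub>3\<^sub>4\<^sup>d\<close>, counted with multiplicity, obeys
  a Pascal-like recursion (\<open>reduced_value\<close>), and extends to an additive functional that reduction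
  steps preserve (\<open>value_at_zero_step\<close>). While \<open>x\<^sub>1\<^sub>2\<close> and \<open>x\<^sub>2\<^sub>3\<close> are both present the
  recursion counts lattice paths; afterwards it is a binomial coefficient. Summing over the end
  points of the paths and taking the difference in the exponent of \<open>x\<^sub>3\<^sub>4\<close> gives
  (\<open>reduced_value_Suc\<close>), with $V(a, b, d)$ for the value at exponent \<open>c = 0\<close> of \<open>x\<^sub>1\<^sub>3\<close>,
  \[ V(n, m + 1, d + 1) - V(n, m + 1, d) = {n + m + d + 2 \choose n} {m + d + 1 \choose d + 1}. \]

  The permutations with \<open>n\<close> ascents, \<open>m + 1\<close> descents and \<open>d + 1\<close> ascents satisfy the same
  recurrence (\<open>card_up_down_up_Suc\<close>), with the same value for \<open>0\<close> final
  ascents. The maximum is at the end or at the peak. If it is at the end, deleting it leaves a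
  permutation with \<open>d\<close> final ascents. If it is at the peak, the \<open>n\<close> values
  before it can be chosen freely, and the other \<open>m + d + 2\<close> values form a valley with \<open>m\<close>
  descents followed by \<open>d + 1\<close> ascents, in ${m + d + 1 \choose d + 1}$ ways.
\<close>

section \<open>Additive functionals and the one-round rewriting operator\<close>

text \<open>\<open>extend f p\<close> sums \<open>f m c\<close> over the terms \<open>c m\<close> of \<open>p\<close>; it is additive
  in \<open>p\<close> when each \<open>f m\<close> is additive.\<close>

definition extend :: "('m \<Rightarrow> 'c::ab_group_add \<Rightarrow> 'r::ab_group_add) \<Rightarrow> ('m \<Rightarrow>\<^sub>0 'c) \<Rightarrow> 'r" where
  "extend f p = (\<Sum>m\<in>Poly_Mapping.keys p. f m (Poly_Mapping.lookup p m))"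

lemma extend_add:
  assumes "\<And>m c d. f m (c + d) = f m c + f m d"
  shows "extend f (p + q) = extend f p + extend f q"
proof -
  have zero: "f m 0 = 0" for m
    using assms[of m 0 0] by simp
  show ?thesis
    unfolding extend_def by (rule setsum_keys_plus_distrib) (use zero assms in auto)
qed

lemma extend_minus:
  assumes "\<And>m c d. f m (c + d) = f m c + f m d"
  shows "extend f (p - q) = extend f p - extend f q"
  using extend_add[of f "p - q" q, OF assms] by simp

lemma extend_single:
  assumes "\<And>m c d. f m (c + d) = f m c + f m d"
  shows "extend f (Poly_Mapping.single m c) = f m c"
  using assms[of m 0 0] by (auto simp: extend_def)

lemma extend_single_id: "extend Poly_Mapping.single p = p"
proof (rule poly_mapping_eqI)
  fix m
  have "Poly_Mapping.lookup (extend Poly_Mapping.single p) m =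
      (\<Sum>x\<in>Poly_Mapping.keys p. if x = m then Poly_Mapping.lookup p x else 0)"
    unfolding extend_def lookup_sum by (intro sum.cong) (auto simp: lookup_single when_def)
  also have "\<dots> = Poly_Mapping.lookup p m"
    by (simp add: in_keys_iff)
  finally show "Poly_Mapping.lookup (extend Poly_Mapping.single p) m = Poly_Mapping.lookup p m" .
qed

text \<open>The replacement polynomial of the term \<open>c m\<close> at the product \<open>x\<^sub>i\<^sub>j x\<^sub>j\<^sub>k\<close>.\<close>

definition contract :: "monomial \<Rightarrow> nat \<Rightarrow> nat \<Rightarrow> nat \<Rightarrow> int poly \<Rightarrow> xpoly" where
  "contract m i j k c = Poly_Mapping.single (m - (evar i j + evar j k)) c
     * (X i k * X i j + X j k * X i k + beta * X i k)"

lemma contract_eq: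
  "contract m i j k c =
     Poly_Mapping.single (m - (evar i j + evar j k) + evar i k + evar i j) c
   + Poly_Mapping.single (m - (evar i j + evar j k) + evar j k + evar i k) c
   + Poly_Mapping.single (m - (evar i j + evar j k) + evar i k) (c * [:0, 1:])"
  by (simp add: contract_def X_def beta_def mult_single distrib_left add.assoc)

lemma contract_add: "contract m i j k (c + d) = contract m i j k c + contract m i j k d"
  by (simp add: contract_def single_add distrib_right)

text \<open>The factor removed from a monomial really divides it, so that the truncated subtraction of
  exponents is exact.\<close>

lemma contains_product_split:
  assumes "contains_product m i j k"
  shows "m = m - (evar i j + evar j k) + evar i j + evar j k"
  using assms
  by (intro poly_mapping_eqI)
    (auto simp: contains_product_def evar_def lookup_add lookup_minus lookup_single when_def)

lemma leftmost_product_unique: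
  assumes "leftmost_product m i j k" and "leftmost_product m i' j' k'"
  shows "i = i' \<and> j = j' \<and> k = k'"
proof -
  have "i < i' \<or> (i = i' \<and> (j < j' \<or> (j = j' \<and> k \<le> k')))"
    and "i' < i \<or> (i' = i \<and> (j' < j \<or> (j' = j \<and> k' \<le> k)))"
    using assms unfolding leftmost_product_def by blast+
  then show ?thesis by linarith
qed

lemma leftmost_product_exists:
  assumes "contains_product m i j k"
  obtains i' j' k' where "leftmost_product m i' j' k'"
proof -
  define i0 where "i0 = (LEAST i. \<exists>j k. contains_product m i j k)"
  define j0 where "j0 = (LEAST j. \<exists>k. contains_product m i0 j k)"
  define k0 where "k0 = (LEAST k. contains_product m i0 j0 k)"
  have "\<exists>i j k. contains_product m i j k" using assms by blast
  then have "\<exists>j k. contains_product m i0 j k" unfolding i0_def by (rule LeastI_ex)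
  then have "\<exists>k. contains_product m i0 j0 k" unfolding j0_def by (rule LeastI_ex)
  then have c: "contains_product m i0 j0 k0" unfolding k0_def by (rule LeastI_ex)
  have "i0 < i' \<or> (i0 = i' \<and> (j0 < j' \<or> (j0 = j' \<and> k0 \<le> k')))"
    if "contains_product m i' j' k'" for i' j' k'
  proof -
    have "i0 \<le> i'" unfolding i0_def by (rule Least_le) (use that in blast)
    moreover have "j0 \<le> j'" if "i' = i0"
      unfolding j0_def by (rule Least_le) (use that \<open>contains_product m i' j' k'\<close> in blast)
    moreover have "k0 \<le> k'" if "i' = i0" "j' = j0"
      unfolding k0_def by (rule Least_le) (use that \<open>contains_product m i' j' k'\<close> in blast)
    ultimately show ?thesis by linarith
  qed
  with c that show thesis unfolding leftmost_product_def by blast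
qed

text \<open>One round of rewriting on a single term; reduced terms are left alone.\<close>

definition rewrite_term :: "monomial \<Rightarrow> int poly \<Rightarrow> xpoly" where
  "rewrite_term m c =
     (if \<exists>i j k. leftmost_product m i j k
      then (let (i, j, k) = (SOME (i, j, k). leftmost_product m i j k) in contract m i j k c)
      else Poly_Mapping.single m c)"

lemma rewrite_term_leftmost:
  assumes "leftmost_product m i j k"
  shows "rewrite_term m c = contract m i j k c"
proof -
  have "(SOME (i, j, k). leftmost_product m i j k) = (i, j, k)"
  proof (rule some_equality)
    fix y assume "case y of (i, j, k) \<Rightarrow> leftmost_product m i j k"
    then show "y = (i, j, k)"
      using leftmost_product_unique[OF assms] by (cases y) auto
  qed (use assms in simp)
  then show ?thesis
    using assms by (auto simp: rewrite_term_def)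
qed

lemma rewrite_term_reduced:
  assumes "\<nexists>i j k. contains_product m i j k"
  shows "rewrite_term m c = Poly_Mapping.single m c"
  using assms by (auto simp: rewrite_term_def leftmost_product_def)

lemma rewrite_term_add: "rewrite_term m (c + d) = rewrite_term m c + rewrite_term m d"
  by (simp add: rewrite_term_def contract_add single_add split: prod.splits)

text \<open>The operator that rewrites every term of a polynomial once, simultaneously. Unlike
  \<^const>\<open>reduction_step\<close> it is a function, and it is additive.\<close>

definition rewrite_all :: "xpoly \<Rightarrow> xpoly" where
  "rewrite_all = extend rewrite_term"

lemma rewrite_all_single: "rewrite_all (Poly_Mapping.single m c) = rewrite_term m c"
  unfolding rewrite_all_def by (rule extend_single) (rule rewrite_term_add)

lemma rewrite_all_iter_add:
  "(rewrite_all ^^ N) (p + q) = (rewrite_all ^^ N) p + (rewrite_all ^^ N) q"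
  by (induction N) (simp_all add: rewrite_all_def extend_add rewrite_term_add)

lemma rewrite_all_iter_minus:
  "(rewrite_all ^^ N) (p - q) = (rewrite_all ^^ N) p - (rewrite_all ^^ N) q"
  unfolding eq_diff_eq rewrite_all_iter_add[symmetric] by simp

lemma rewrite_all_reduced:
  assumes "is_reduced p"
  shows "rewrite_all p = p"
proof -
  have "rewrite_all p = extend Poly_Mapping.single p"
    unfolding rewrite_all_def extend_def
    using assms by (intro sum.cong) (auto simp: is_reduced_def rewrite_term_reduced)
  then show ?thesis by (simp add: extend_single_id)
qed

lemma rewrite_all_iter_reduced: "is_reduced p \<Longrightarrow> (rewrite_all ^^ N) p = p"
  by (induction N) (simp_all add: rewrite_all_reduced)

lemma is_reduced_add: "is_reduced p \<Longrightarrow> is_reduced q \<Longrightarrow> is_reduced (p + q)"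
  unfolding is_reduced_def using Poly_Mapping.keys_add[of p q] by blast

lemma reduction_step_cases:
  assumes "reduction_step p q"
  obtains m i j k where "m \<in> Poly_Mapping.keys p" "leftmost_product m i j k"
    "q = p - Poly_Mapping.single m (Poly_Mapping.lookup p m)
         + contract m i j k (Poly_Mapping.lookup p m)"
  using assms
proof cases
  case (1 m i j k)
  show thesis by (rule that[OF 1(2,3)]) (simp only: 1(1) contract_def)
qed

text \<open>The three monomials that a replacement at \<open>x\<^sub>i\<^sub>j x\<^sub>j\<^sub>k\<close> can produce.\<close>

definition replacements :: "monomial \<Rightarrow> nat \<Rightarrow> nat \<Rightarrow> nat \<Rightarrow> monomial set" where
  "replacements m i j k =
     {m - (evar i j + evar j k) + evar i k + evar i j,
      m - (evar i j + evar j k) + evar j k + evar i k,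
      m - (evar i j + evar j k) + evar i k}"

lemma keys_single_subset: "Poly_Mapping.keys (Poly_Mapping.single m c) \<subseteq> {m}"
  by simp

lemma keys_contract_subset: "Poly_Mapping.keys (contract m i j k c) \<subseteq> replacements m i j k"
  unfolding contract_eq replacements_def
  by (intro subset_trans[OF Poly_Mapping.keys_add] Un_least subset_trans[OF keys_single_subset]) simp_all

lemma card_replacements: "finite (replacements m i j k)" "card (replacements m i j k) \<le> 3"
  using card_length[of "[m - (evar i j + evar j k) + evar i k + evar i j,
      m - (evar i j + evar j k) + evar j k + evar i k, m - (evar i j + evar j k) + evar i k]"]
  by (simp_all add: replacements_def)

lemma keys_step_subset:
  "Poly_Mapping.keys (p - Poly_Mapping.single m (Poly_Mapping.lookup p m) + contract m i j k c) \<subseteq>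
     (Poly_Mapping.keys p - {m}) \<union> replacements m i j k"
  by (intro subset_trans[OF Poly_Mapping.keys_add] Un_mono keys_contract_subset)
    (auto simp: in_keys_iff lookup_minus lookup_single when_def split: if_splits)

section \<open>Termination, existence and uniqueness\<close>

text \<open>For monomials in variables with indices at most \<open>L\<close>, a long variable \<open>x\<^sub>i\<^sub>j\<close> weighs less
  than a short one. Each replacement turns a variable into a longer one or discards it, and thus
  lowers the total weight.\<close>

definition indices_le :: "nat \<Rightarrow> monomial \<Rightarrow> bool" where
  "indices_le L m \<longleftrightarrow> Poly_Mapping.keys m \<subseteq> {..L} \<times> {..L}"

definition weight :: "nat \<Rightarrow> monomial \<Rightarrow> nat" where
  "weight L m = (\<Sum>(i, j)\<in>{..L} \<times> {..L}. Poly_Mapping.lookup m (i, j) * (L + 1 + i - j))"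

lemma weight_add: "weight L (m + m') = weight L m + weight L m'"
  by (simp add: weight_def lookup_add distrib_right sum.distrib case_prod_unfold)

lemma weight_evar:
  assumes "i \<le> L" and "j \<le> L"
  shows "weight L (evar i j) = L + 1 + i - j"
proof -
  have "weight L (evar i j) = (\<Sum>v\<in>{..L} \<times> {..L}. if v = (i, j) then L + 1 + i - j else 0)"
    unfolding weight_def
    by (intro sum.cong) (auto simp: evar_def lookup_single when_def split: if_splits)
  also have "\<dots> = L + 1 + i - j" using assms by simp
  finally show ?thesis .
qed

lemma indices_le_contains_product:
  assumes "indices_le L m" and "contains_product m i j k"
  shows "i < j" and "j < k" and "k \<le> L"
proof -
  have "(j, k) \<in> Poly_Mapping.keys m"
    using assms(2) by (simp add: contains_product_def in_keys_iff)
  then show "k \<le> L" using assms(1) by (auto simp: indices_le_def)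
qed (use assms(2) in \<open>simp_all add: contains_product_def\<close>)

lemma replacements_smaller:
  assumes "indices_le L m" and "contains_product m i j k"
    and "m' \<in> replacements m i j k"
  shows "indices_le L m'" and "weight L m' < weight L m"
proof -
  define r where "r = m - (evar i j + evar j k)"
  have ijk: "i < j" "j < k" "k \<le> L"
    using indices_le_contains_product[OF assms(1,2)] by auto
  have m: "m = r + evar i j + evar j k"
    unfolding r_def by (rule contains_product_split[OF assms(2)])
  have m': "m' \<in> {r + evar i k + evar i j, r + evar j k + evar i k, r + evar i k}"
    using assms(3) unfolding r_def replacements_def .
  have "Poly_Mapping.keys r \<subseteq> Poly_Mapping.keys m"
    by (auto simp: r_def in_keys_iff lookup_minus)
  then have r: "indices_le L r" using assms(1) unfolding indices_le_def by (rule subset_trans)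
  have "i \<le> L" "j \<le> L" using ijk by linarith+
  then have vars: "indices_le L (evar i j)" "indices_le L (evar j k)" "indices_le L (evar i k)"
    using \<open>k \<le> L\<close> by (simp_all add: indices_le_def evar_def)
  have add: "indices_le L (a + b)" if "indices_le L a" "indices_le L b" for a b
    using that subset_trans[OF Poly_Mapping.keys_add[of a b] Un_least]
    unfolding indices_le_def by blast
  show "indices_le L m'"
    using m' add r vars by (elim insertE emptyE) simp_all
  show "weight L m' < weight L m"
  proof -
    have "weight L (evar i k) < weight L (evar i j)" "weight L (evar i k) < weight L (evar j k)"
      using ijk \<open>i \<le> L\<close> \<open>j \<le> L\<close> by (simp_all only: weight_evar)
    moreover have "weight L m = weight L r + weight L (evar i j) + weight L (evar j k)"
      using arg_cong[OF m, of "weight L"] by (simp only: weight_add)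
    moreover have "weight L m' = weight L r + weight L (evar i k) + weight L (evar i j) \<or>
        weight L m' = weight L r + weight L (evar j k) + weight L (evar i k) \<or>
        weight L m' = weight L r + weight L (evar i k)"
      using m' by (elim insertE emptyE) (simp_all only: weight_add simp_thms)
    ultimately show ?thesis by linarith
  qed
qed

text \<open>A term is fully reduced after as many rounds as its weight.\<close>

lemma rewrite_iter_single_reduced:
  assumes "indices_le L m" and "weight L m \<le> N"
  shows "is_reduced ((rewrite_all ^^ N) (Poly_Mapping.single m c))"
  using assms
proof (induction N arbitrary: m c)
  case 0
  have "\<not> contains_product m i j k" for i j k
  proof
    assume c: "contains_product m i j k"
    show False
      using replacements_smaller(2)[OF 0(1) c, of "m - (evar i j + evar j k) + evar i k"] 0(2)
      by (simp add: replacements_def)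
  qed
  then show ?case by (auto simp: is_reduced_def split: if_splits)
next
  case (Suc N)
  show ?case
  proof (cases "\<exists>i j k. contains_product m i j k")
    case False
    then have "is_reduced (Poly_Mapping.single m c)" by (auto simp: is_reduced_def)
    then show ?thesis unfolding rewrite_all_iter_reduced[OF \<open>is_reduced _\<close>] .
  next
    case True
    then obtain i j k where lm: "leftmost_product m i j k"
      using leftmost_product_exists by metis
    then have cp: "contains_product m i j k" by (simp add: leftmost_product_def)
    have *: "is_reduced ((rewrite_all ^^ N) (Poly_Mapping.single m' d))"
      if "m' \<in> replacements m i j k" for m' d
      using Suc.IH[of m' d] replacements_smaller[OF Suc.prems(1) cp that] Suc.prems(2) by simp
    have "(rewrite_all ^^ Suc N) (Poly_Mapping.single m c) = (rewrite_all ^^ N) (contract m i j k c)"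
      unfolding funpow_Suc_right comp_def rewrite_all_single rewrite_term_leftmost[OF lm] ..
    also have "is_reduced \<dots>"
      unfolding contract_eq rewrite_all_iter_add by (intro is_reduced_add *) (auto simp: replacements_def)
    finally show ?thesis .
  qed
qed

text \<open>After \<open>N\<close> rounds a term and its contraction agree, since the former is then reduced and
  one more round does not change it. This makes the outcome of \<open>N\<close> rounds invariant under
  reduction steps.\<close>

lemma rewrite_iter_step_invariant:
  assumes "reduction_step p q"
    and bound: "\<forall>m\<in>Poly_Mapping.keys p. indices_le L m \<and> weight L m \<le> N"
  shows "(rewrite_all ^^ N) q = (rewrite_all ^^ N) p"
    and "\<forall>m\<in>Poly_Mapping.keys q. indices_le L m \<and> weight L m \<le> N"
proof -
  obtain m i j k where m: "m \<in> Poly_Mapping.keys p" and lm: "leftmost_product m i j k"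
    and q: "q = p - Poly_Mapping.single m (Poly_Mapping.lookup p m)
         + contract m i j k (Poly_Mapping.lookup p m)"
    using assms(1) by (rule reduction_step_cases)
  let ?s = "Poly_Mapping.single m (Poly_Mapping.lookup p m)"
  have red: "is_reduced ((rewrite_all ^^ N) ?s)"
    using bound m by (intro rewrite_iter_single_reduced) auto
  have "(rewrite_all ^^ N) (contract m i j k (Poly_Mapping.lookup p m)) = (rewrite_all ^^ Suc N) ?s"
    unfolding funpow_Suc_right comp_def rewrite_all_single rewrite_term_leftmost[OF lm] ..
  also have "\<dots> = (rewrite_all ^^ N) ?s"
    using rewrite_all_reduced[OF red] by simp
  finally show "(rewrite_all ^^ N) q = (rewrite_all ^^ N) p"
    by (simp add: q rewrite_all_iter_add rewrite_all_iter_minus)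
  show "\<forall>m\<in>Poly_Mapping.keys q. indices_le L m \<and> weight L m \<le> N"
  proof
    fix m' assume "m' \<in> Poly_Mapping.keys q"
    then have "m' \<in> Poly_Mapping.keys p \<or> m' \<in> replacements m i j k"
      using keys_step_subset unfolding q by blast
    then show "indices_le L m' \<and> weight L m' \<le> N"
    proof
      assume "m' \<in> replacements m i j k"
      moreover have "contains_product m i j k" using lm by (simp add: leftmost_product_def)
      ultimately show ?thesis
        using bspec[OF bound m] replacements_smaller[of L m i j k m'] by linarith
    qed (rule bspec[OF bound])
  qed
qed

lemma rewrite_iter_steps_invariant:
  assumes "reduction_step\<^sup>*\<^sup>* p q"
    and "\<forall>m\<in>Poly_Mapping.keys p. indices_le L m \<and> weight L m \<le> N"
  shows "(rewrite_all ^^ N) q = (rewrite_all ^^ N) p \<and>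
    (\<forall>m\<in>Poly_Mapping.keys q. indices_le L m \<and> weight L m \<le> N)"
  using assms(1)
proof (induction rule: rtranclp_induct)
  case base
  then show ?case using assms(2) by blast
next
  case (step q r)
  note inv = rewrite_iter_step_invariant[OF step.hyps(2) conjunct2[OF step.IH]]
  show ?case using inv step.IH by argo
qed

text \<open>Since each monomial is replaced by at most three lighter ones, giving a monomial the
  measure \<open>4 ^ weight\<close> makes the sum over the support decrease, whatever cancels.\<close>

lemma reduces_to_reduced:
  assumes "\<And>m. m \<in> Poly_Mapping.keys p \<Longrightarrow> indices_le L m"
  shows "\<exists>q. reduction_step\<^sup>*\<^sup>* p q \<and> is_reduced q"
  using assms
proof (induction "\<Sum>m\<in>Poly_Mapping.keys p. (4::nat) ^ weight L m" arbitrary: p rule: less_induct)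
  case less
  show ?case
  proof (cases "is_reduced p")
    case False
    then obtain m i j k where m: "m \<in> Poly_Mapping.keys p" and "contains_product m i j k"
      by (auto simp: is_reduced_def)
    then obtain i j k where lm: "leftmost_product m i j k"
      using leftmost_product_exists by metis
    then have cp: "contains_product m i j k" by (simp add: leftmost_product_def)
    define q where "q = p - Poly_Mapping.single m (Poly_Mapping.lookup p m)
         + contract m i j k (Poly_Mapping.lookup p m)"
    have step: "reduction_step p q"
      unfolding q_def contract_def using m lm by (rule reduction_step.intros)
    have sub: "Poly_Mapping.keys q \<subseteq> (Poly_Mapping.keys p - {m}) \<union> replacements m i j k"
      unfolding q_def by (rule keys_step_subset)
    have small: "indices_le L m'" "weight L m' < weight L m"
      if "m' \<in> replacements m i j k" for m'
      using replacements_smaller[OF less.prems[OF m] cp that] by auto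
    obtain w where w: "weight L m = Suc w"
      using small(2)[of "m - (evar i j + evar j k) + evar i k"]
      by (cases "weight L m") (auto simp: replacements_def)
    have "(\<Sum>m'\<in>replacements m i j k. (4::nat) ^ weight L m') \<le> card (replacements m i j k) * 4 ^ w"
      using sum_bounded_above[of "replacements m i j k" "\<lambda>m'. (4::nat) ^ weight L m'" "4 ^ w"]
        small(2) w by (auto simp: less_Suc_eq_le)
    also have "\<dots> \<le> 3 * 4 ^ w"
      using card_replacements(2) by (rule mult_right_mono) simp
    also have "\<dots> < 4 ^ weight L m" by (simp add: w)
    finally have lt: "(\<Sum>m'\<in>replacements m i j k. (4::nat) ^ weight L m') < 4 ^ weight L m" .
    have "(\<Sum>m'\<in>Poly_Mapping.keys q. (4::nat) ^ weight L m')
        \<le> (\<Sum>m'\<in>(Poly_Mapping.keys p - {m}) \<union> replacements m i j k. 4 ^ weight L m')"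
      by (rule sum_mono2) (use sub card_replacements(1) in auto)
    also have "\<dots> \<le> (\<Sum>m'\<in>Poly_Mapping.keys p - {m}. 4 ^ weight L m')
        + (\<Sum>m'\<in>replacements m i j k. 4 ^ weight L m')"
      using sum.union_inter[of "Poly_Mapping.keys p - {m}" "replacements m i j k"
          "\<lambda>m'. (4::nat) ^ weight L m'"] card_replacements(1) by simp
    also have "\<dots> < (\<Sum>m'\<in>Poly_Mapping.keys p - {m}. 4 ^ weight L m') + 4 ^ weight L m"
      using lt by simp
    also have "\<dots> = (\<Sum>m'\<in>Poly_Mapping.keys p. 4 ^ weight L m')"
      using sum.remove[OF _ m, of "\<lambda>m'. (4::nat) ^ weight L m'"] by simp
    finally have decrease: "(\<Sum>m'\<in>Poly_Mapping.keys q. (4::nat) ^ weight L m')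
        < (\<Sum>m'\<in>Poly_Mapping.keys p. 4 ^ weight L m')" .
    have "indices_le L m'" if "m' \<in> Poly_Mapping.keys q" for m'
      using that sub less.prems[of m'] small(1)[of m'] by auto
    then have "\<exists>r. reduction_step\<^sup>*\<^sup>* q r \<and> is_reduced r"
      using less.hyps[OF decrease] by simp
    then show ?thesis using step by (meson converse_rtranclp_into_rtranclp)
  qed blast
qed

theorem reduced_polynomial_unique_existence: "\<exists>!Q. is_reduced_polynomial_of M Q"
proof -
  define L where "L = Max (insert 0 (\<Union>m\<in>Poly_Mapping.keys M. \<Union>(i, j)\<in>Poly_Mapping.keys m. {i, j}))"
  define N where "N = Max (insert 0 (weight L ` Poly_Mapping.keys M))"
  have fin: "finite (insert 0 (\<Union>m\<in>Poly_Mapping.keys M. \<Union>(i, j)\<in>Poly_Mapping.keys m. {i, j}))"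
    by auto
  have ind: "indices_le L m" if "m \<in> Poly_Mapping.keys M" for m
    unfolding indices_le_def
  proof clarify
    fix i j assume "(i, j) \<in> Poly_Mapping.keys m"
    then have "i \<in> (\<Union>m\<in>Poly_Mapping.keys M. \<Union>(i, j)\<in>Poly_Mapping.keys m. {i, j})"
      "j \<in> (\<Union>m\<in>Poly_Mapping.keys M. \<Union>(i, j)\<in>Poly_Mapping.keys m. {i, j})"
      using that by auto
    then show "i \<in> {..L} \<and> j \<in> {..L}"
      unfolding L_def by (simp only: atMost_iff Max_ge[OF fin] insertI2 simp_thms)
  qed
  have N: "weight L m \<le> N" if "m \<in> Poly_Mapping.keys M" for m
    unfolding N_def using that by (intro Max_ge) auto
  have unique: "Q = (rewrite_all ^^ N) M" if "is_reduced_polynomial_of M Q" for Q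
  proof -
    have "reduction_step\<^sup>*\<^sup>* M Q" "is_reduced Q"
      using that by (auto simp: is_reduced_polynomial_of_def)
    then show ?thesis
      using rewrite_iter_steps_invariant[of M Q L N] rewrite_all_iter_reduced[of Q N] ind N by auto
  qed
  show ?thesis
  proof (rule ex_ex1I)
    show "\<exists>Q. is_reduced_polynomial_of M Q"
      using reduces_to_reduced[of M L] ind unfolding is_reduced_polynomial_of_def by blast
    show "Q = Q'" if "is_reduced_polynomial_of M Q" "is_reduced_polynomial_of M Q'" for Q Q'
      unfolding unique[OF that(1)] unique[OF that(2)] ..
  qed
qed

lemma reduced_polynomial_spec:
  "reduction_step\<^sup>*\<^sup>* M (reduced_polynomial M)" "is_reduced (reduced_polynomial M)"
  using theI'[OF reduced_polynomial_unique_existence[of M]]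
  by (simp_all add: is_reduced_polynomial_of_def reduced_polynomial_def)

section \<open>The reduced polynomial at \<open>\<beta> = 0\<close>\<close>

text \<open>The value at \<open>\<beta> = 0\<close> and \<open>x\<^sub>i\<^sub>j = 1\<close> of the reduced polynomial of
  \<open>x\<^sub>1\<^sub>2\<^sup>a x\<^sub>2\<^sub>3\<^sup>b x\<^sub>1\<^sub>3\<^sup>c x\<^sub>3\<^sub>4\<^sup>d\<close>. Once \<open>x\<^sub>1\<^sub>2\<close> or \<open>x\<^sub>2\<^sub>3\<close> is used up, the
  variable \<open>x\<^sub>3\<^sub>4\<close> reacts with \<open>x\<^sub>1\<^sub>3\<close> and then with \<open>x\<^sub>2\<^sub>3\<close>, which gives the
  binomial coefficients.\<close>

fun reduced_value :: "nat \<Rightarrow> nat \<Rightarrow> nat \<Rightarrow> nat \<Rightarrow> nat" where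
  "reduced_value 0 b c d = (b + c + d) choose d"
| "reduced_value (Suc a) 0 c d = (c + d) choose d"
| "reduced_value (Suc a) (Suc b) c d =
     reduced_value (Suc a) b (Suc c) d + reduced_value a (Suc b) (Suc c) d"

lemma reduced_value_exhausted:
  assumes "a = 0 \<or> b = 0"
  shows "reduced_value a b c d = (b + c + d) choose d"
  using assms by (cases a) auto

lemma reduced_value_extend_123:
  "a > 0 \<Longrightarrow> b > 0 \<Longrightarrow>
     reduced_value a b c d = reduced_value a (b - 1) (Suc c) d + reduced_value (a - 1) b (Suc c) d"
  by (cases a; cases b) simp_all

text \<open>The value of a monomial; the exponents of \<open>x\<^sub>1\<^sub>4\<close> and \<open>x\<^sub>2\<^sub>4\<close> do not matter, because
  these variables take no part in the reduction of the monomials called admissible below.\<close>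

definition monomial_value :: "monomial \<Rightarrow> int" where
  "monomial_value m = int (reduced_value (Poly_Mapping.lookup m (1, 2)) (Poly_Mapping.lookup m (2, 3))
     (Poly_Mapping.lookup m (1, 3)) (Poly_Mapping.lookup m (3, 4)))"

text \<open>The additive extension of \<^const>\<open>monomial_value\<close> to polynomials, with the coefficients
  taken at \<open>\<beta> = 0\<close>.\<close>

definition value_at_zero :: "xpoly \<Rightarrow> int" where
  "value_at_zero = extend (\<lambda>m c. poly c 0 * monomial_value m)"

lemma value_at_zero_add: "value_at_zero (p + q) = value_at_zero p + value_at_zero q"
  unfolding value_at_zero_def by (rule extend_add) (simp add: distrib_right)

lemma value_at_zero_minus: "value_at_zero (p - q) = value_at_zero p - value_at_zero q"
  unfolding value_at_zero_def by (rule extend_minus) (simp add: distrib_right)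

lemma value_at_zero_single: "value_at_zero (Poly_Mapping.single m c) = poly c 0 * monomial_value m"
  unfolding value_at_zero_def by (rule extend_single) (simp add: distrib_right)

text \<open>The monomials that can occur. Leftmost rewriting never has \<open>x\<^sub>1\<^sub>2\<close> and \<open>x\<^sub>2\<^sub>4\<close> side by
  side: \<open>x\<^sub>2\<^sub>4\<close> comes from \<open>x\<^sub>2\<^sub>3 x\<^sub>3\<^sub>4\<close>, which waits until no \<open>x\<^sub>1\<^sub>2\<close> is left.\<close>

definition admissible :: "monomial \<Rightarrow> bool" where
  "admissible m \<longleftrightarrow> Poly_Mapping.keys m \<subseteq> {(1,2), (2,3), (1,3), (3,4), (1,4), (2,4)} \<and>
     (Poly_Mapping.lookup m (1, 2) = 0 \<or> Poly_Mapping.lookup m (2, 4) = 0)"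

lemma admissible_contains_product:
  assumes "admissible m" and "contains_product m i j k"
  shows "(i, j, k) \<in> {(1, 2, 3), (1, 3, 4), (2, 3, 4)}"
proof -
  have "(i, j) \<in> Poly_Mapping.keys m" "(j, k) \<in> Poly_Mapping.keys m"
    using assms(2) by (auto simp: contains_product_def in_keys_iff)
  then have "(i, j) \<in> {(1,2), (2,3), (1,3), (3,4), (1,4), (2,4)}"
    "(j, k) \<in> {(1,2), (2,3), (1,3), (3,4), (1,4), (2,4)}"
    using assms(1) unfolding admissible_def by blast+
  moreover have "(i, j, k) \<noteq> (1, 2, 4)"
    using assms by (auto simp: admissible_def contains_product_def)
  ultimately show ?thesis
    by (elim insertE emptyE) simp_all
qed

lemma admissible_leftmost_cases:
  assumes "admissible m" and "leftmost_product m i j k"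
  obtains (x123) "i = 1" "j = 2" "k = 3"
      "Poly_Mapping.lookup m (1, 2) > 0" "Poly_Mapping.lookup m (2, 3) > 0"
  | (x134) "i = 1" "j = 3" "k = 4"
      "Poly_Mapping.lookup m (1, 3) > 0" "Poly_Mapping.lookup m (3, 4) > 0"
      "Poly_Mapping.lookup m (1, 2) = 0 \<or> Poly_Mapping.lookup m (2, 3) = 0"
  | (x234) "i = 2" "j = 3" "k = 4"
      "Poly_Mapping.lookup m (2, 3) > 0" "Poly_Mapping.lookup m (3, 4) > 0"
      "Poly_Mapping.lookup m (1, 2) = 0" "Poly_Mapping.lookup m (1, 3) = 0"
proof -
  have cp: "contains_product m i j k"
    using assms(2) by (simp add: leftmost_product_def)
  have first: "i < i' \<or> (i = i' \<and> (j < j' \<or> (j = j' \<and> k \<le> k')))"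
    if "contains_product m i' j' k'" for i' j' k'
    using assms(2) that unfolding leftmost_product_def by blast
  consider "i = 1 \<and> j = 2 \<and> k = 3" | "i = 1 \<and> j = 3 \<and> k = 4" | "i = 2 \<and> j = 3 \<and> k = 4"
    using admissible_contains_product[OF assms(1) cp] by auto
  then show thesis
  proof cases
    case 1
    then show thesis using cp by (intro x123) (auto simp: contains_product_def)
  next
    case 2
    then have "\<not> contains_product m 1 2 3" using first[of 1 2 3] by auto
    with 2 show thesis using cp by (intro x134) (auto simp: contains_product_def)
  next
    case 3
    then have "\<not> contains_product m 1 2 3" "\<not> contains_product m 1 3 4"
      using first[of 1 2 3] first[of 1 3 4] by auto
    with 3 show thesis using cp by (intro x234) (auto simp: contains_product_def)
  qed
qed

lemma admissible_replacements:
  assumes "admissible m" and "leftmost_product m i j k" and "m' \<in> replacements m i j k"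
  shows "admissible m'"
proof -
  let ?r = "m - (evar i j + evar j k)"
  have keys_var: "v \<in> Poly_Mapping.keys (a + evar s t) \<Longrightarrow> v \<in> Poly_Mapping.keys a \<or> v = (s, t)"
    for a s t v
    using Poly_Mapping.keys_add[of a "evar s t"] by (auto simp: evar_def)
  have keys_r: "v \<in> Poly_Mapping.keys ?r \<Longrightarrow> v \<in> Poly_Mapping.keys m" for v
    by (simp add: in_keys_iff lookup_minus)
  have key: "v \<in> Poly_Mapping.keys m \<or> v \<in> {(i, j), (j, k), (i, k)}"
    if "v \<in> Poly_Mapping.keys m'" for v
    using assms(3) that unfolding replacements_def
    by (elim insertE emptyE) (auto dest!: keys_var keys_r)
  have adm: "v \<in> Poly_Mapping.keys m \<Longrightarrow> v \<in> {(1,2), (2,3), (1,3), (3,4), (1,4), (2,4)}"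
    "(1, 2) \<notin> Poly_Mapping.keys m \<or> (2, 4) \<notin> Poly_Mapping.keys m" for v
    using assms(1) unfolding admissible_def by (blast, simp add: in_keys_iff)
  have "(v \<in> Poly_Mapping.keys m' \<longrightarrow> v \<in> {(1,2), (2,3), (1,3), (3,4), (1,4), (2,4)}) \<and>
    ((1, 2) \<notin> Poly_Mapping.keys m' \<or> (2, 4) \<notin> Poly_Mapping.keys m')" for v
  proof (cases rule: admissible_leftmost_cases[OF assms(1,2)])
    case 1
    then have "(1, 2) \<in> Poly_Mapping.keys m" by (simp add: in_keys_iff)
    then show ?thesis using 1(1-3) key[of v] key[of "(2, 4)"] adm(1)[of v] adm(2) by auto
  next
    case 2
    show ?thesis using 2(1-3) key[of v] key[of "(1, 2)"] key[of "(2, 4)"] adm(1)[of v] adm(2) by auto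
  next
    case 3
    then have "(1, 2) \<notin> Poly_Mapping.keys m" by (simp add: in_keys_iff)
    then show ?thesis using 3(1-3) key[of v] key[of "(1, 2)"] adm(1)[of v] adm(2) by auto
  qed
  then show ?thesis by (simp add: admissible_def in_keys_iff subset_iff)
qed

lemma monomial_value_replace:
  assumes "admissible m" and "leftmost_product m i j k"
  shows "monomial_value m =
     monomial_value (m - (evar i j + evar j k) + evar i k + evar i j)
   + monomial_value (m - (evar i j + evar j k) + evar j k + evar i k)"
  using assms
proof (cases rule: admissible_leftmost_cases)
  case x123
  then show ?thesis
    using reduced_value_extend_123[OF x123(4,5)]
    by (simp add: monomial_value_def lookup_add lookup_minus evar_def lookup_single when_def)
next
  case x134
  then obtain c d where "Poly_Mapping.lookup m (1, 3) = Suc c" "Poly_Mapping.lookup m (3, 4) = Suc d"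
    using gr0_implies_Suc by metis
  with x134 show ?thesis
    by (auto simp: monomial_value_def lookup_add lookup_minus evar_def lookup_single when_def
        reduced_value_exhausted)
next
  case x234
  then obtain c d where "Poly_Mapping.lookup m (2, 3) = Suc c" "Poly_Mapping.lookup m (3, 4) = Suc d"
    using gr0_implies_Suc by metis
  with x234 show ?thesis
    by (auto simp: monomial_value_def lookup_add lookup_minus evar_def lookup_single when_def
        reduced_value_exhausted)
qed

lemma value_at_zero_step:
  assumes "reduction_step p q" and "\<forall>m\<in>Poly_Mapping.keys p. admissible m"
  shows "value_at_zero q = value_at_zero p \<and> (\<forall>m\<in>Poly_Mapping.keys q. admissible m)"
proof -
  obtain m i j k where m: "m \<in> Poly_Mapping.keys p" and lm: "leftmost_product m i j k"
    and q: "q = p - Poly_Mapping.single m (Poly_Mapping.lookup p m)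
         + contract m i j k (Poly_Mapping.lookup p m)"
    using assms(1) by (rule reduction_step_cases)
  have "value_at_zero q = value_at_zero p"
    using monomial_value_replace[of m i j k] assms(2) m lm
    by (simp add: q contract_eq value_at_zero_add value_at_zero_minus value_at_zero_single
        distrib_left)
  moreover have "\<forall>m\<in>Poly_Mapping.keys q. admissible m"
    using keys_step_subset[of p m i j k "Poly_Mapping.lookup p m"] assms(2) m
      admissible_replacements[OF _ lm] unfolding q by blast
  ultimately show ?thesis ..
qed

lemma value_at_zero_steps:
  assumes "reduction_step\<^sup>*\<^sup>* p q" and "\<forall>m\<in>Poly_Mapping.keys p. admissible m"
  shows "value_at_zero q = value_at_zero p \<and> (\<forall>m\<in>Poly_Mapping.keys q. admissible m)"
  using assms by (induction rule: rtranclp_induct) (auto dest: value_at_zero_step)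

lemma monomial_value_reduced:
  assumes "\<nexists>i j k. contains_product m i j k"
  shows "monomial_value m = 1"
proof -
  have "\<not> contains_product m 1 2 3" "\<not> contains_product m 1 3 4" "\<not> contains_product m 2 3 4"
    using assms by auto
  then have "(Poly_Mapping.lookup m (1, 2) = 0 \<or> Poly_Mapping.lookup m (2, 3) = 0)"
    "Poly_Mapping.lookup m (3, 4) = 0 \<or>
      (Poly_Mapping.lookup m (1, 3) = 0 \<and> Poly_Mapping.lookup m (2, 3) = 0)"
    by (auto simp: contains_product_def)
  then show ?thesis by (auto simp: monomial_value_def reduced_value_exhausted)
qed

lemma P_at_zero:
  assumes "\<forall>m\<in>Poly_Mapping.keys M. admissible m"
  shows "poly (P M) 0 = value_at_zero M"
proof -
  have red: "is_reduced (reduced_polynomial M)" by (rule reduced_polynomial_spec)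
  have "poly (P M) 0 = (\<Sum>m\<in>Poly_Mapping.keys (reduced_polynomial M).
      poly (Poly_Mapping.lookup (reduced_polynomial M) m) 0)"
    by (simp add: P_def eval_vars_def poly_sum)
  also have "\<dots> = value_at_zero (reduced_polynomial M)"
    unfolding value_at_zero_def extend_def
    using red by (intro sum.cong) (simp_all add: is_reduced_def monomial_value_reduced)
  also have "\<dots> = value_at_zero M"
    using value_at_zero_steps[OF reduced_polynomial_spec(1) assms] ..
  finally show ?thesis .
qed

lemma X_power: "X i j ^ n = Poly_Mapping.single (Poly_Mapping.single (i, j) n) 1"
proof (induction n)
  case (Suc n)
  show ?case
    unfolding power_Suc Suc.IH by (simp add: X_def evar_def mult_single flip: single_add)
qed simp

lemma P_initial_monomial:
  "poly (P ((X 1 2 * X 2 3) ^ n * X 3 4 ^ k)) 0 = int (reduced_value n n 0 k)"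
proof -
  define m where "m = Poly_Mapping.single (1::nat, 2::nat) n + Poly_Mapping.single (2, 3) n
    + Poly_Mapping.single (3, 4) k"
  have M: "(X 1 2 * X 2 3) ^ n * X 3 4 ^ k = Poly_Mapping.single m 1"
    by (simp add: power_mult_distrib X_power mult_single m_def)
  have look: "Poly_Mapping.lookup m v =
      (if v = (1, 2) \<or> v = (2, 3) then n else if v = (3, 4) then k else 0)" for v
    by (auto simp: m_def lookup_add lookup_single when_def)
  have "admissible m"
    by (auto simp: admissible_def look in_keys_iff split: if_splits)
  then have "poly (P (Poly_Mapping.single m 1)) 0 = value_at_zero (Poly_Mapping.single m 1)"
    by (intro P_at_zero) simp
  then show ?thesis
    unfolding M by (simp add: value_at_zero_single monomial_value_def look)
qed

section \<open>A recurrence in the exponent of \<open>x\<^sub>3\<^sub>4\<close>\<close>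

lemma sum_choose_column: "(\<Sum>i<a. (i + b) choose b) = (a + b) choose Suc b"
  by (induction a) auto

text \<open>A closed form: \<open>i\<close> is the exponent that \<open>x\<^sub>1\<^sub>2\<close> has lost when the last \<open>x\<^sub>2\<^sub>3\<close>
  disappears; the last summand collects the monomials in which \<open>x\<^sub>1\<^sub>2\<close> disappears first.\<close>

lemma reduced_value_closed:
  "reduced_value a (Suc b) c d =
     (\<Sum>i<a. ((i + b) choose b) * ((c + i + b + 1 + d) choose d))
     + ((a + b) choose a) * ((c + a + b + 1 + d) choose d)"
proof (induction a arbitrary: b c)
  case 0
  then show ?case by (simp add: add.commute)
next
  case (Suc a)
  note outer = Suc.IH
  show ?case
  proof (induction b arbitrary: c)
    case 0
    have "reduced_value (Suc a) (Suc 0) c d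
        = ((Suc c + d) choose d) + reduced_value a (Suc 0) (Suc c) d" by simp
    also have "reduced_value a (Suc 0) (Suc c) d
        = (\<Sum>i<a. (c + Suc i + 1 + d) choose d) + ((Suc c + a + 1 + d) choose d)"
      by (simp add: Suc.IH)
    finally show ?case by (simp add: sum.lessThan_Suc_shift del: sum.lessThan_Suc)
  next
    case (Suc b)
    define f where "f x = (x + 1 + d) choose d" for x
    have "reduced_value (Suc a) (Suc (Suc b)) c d
        = reduced_value (Suc a) (Suc b) (Suc c) d + reduced_value a (Suc (Suc b)) (Suc c) d" by simp
    also have "reduced_value (Suc a) (Suc b) (Suc c) d
        = (\<Sum>i<Suc a. ((i + b) choose b) * f (Suc c + i + b))
          + ((Suc a + b) choose Suc a) * f (c + a + b + 2)"
      by (subst Suc.IH) (simp add: f_def)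
    also have "(\<Sum>i<Suc a. ((i + b) choose b) * f (Suc c + i + b))
        = f (c + b + 1) + (\<Sum>i<a. ((Suc i + b) choose b) * f (c + i + b + 2))"
      by (subst sum.lessThan_Suc_shift) simp
    also have "reduced_value a (Suc (Suc b)) (Suc c) d
        = (\<Sum>i<a. ((Suc i + b) choose Suc b) * f (c + i + b + 2))
          + ((Suc a + b) choose a) * f (c + a + b + 2)"
      by (subst outer) (simp add: f_def)
    finally have "reduced_value (Suc a) (Suc (Suc b)) c d
        = f (c + b + 1) + (\<Sum>i<a. ((Suc (Suc i) + b) choose Suc b) * f (c + i + b + 2))
          + ((Suc (Suc a) + b) choose Suc a) * f (c + a + b + 2)"
      by (simp add: sum.distrib distrib_right)
    also have "f (c + b + 1) + (\<Sum>i<a. ((Suc (Suc i) + b) choose Suc b) * f (c + i + b + 2))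
        = (\<Sum>i<Suc a. ((i + Suc b) choose Suc b) * f (c + i + Suc b))"
      by (subst sum.lessThan_Suc_shift) simp
    finally show ?case by (simp add: f_def)
  qed
qed

lemma reduced_value_0: "reduced_value a (Suc b) 0 0 = (a + b + 1) choose a"
proof -
  have "reduced_value a (Suc b) 0 0 = ((a + b) choose Suc b) + ((a + b) choose a)"
    by (simp add: reduced_value_closed sum_choose_column)
  also have "(a + b) choose a = (a + b) choose b"
    using binomial_symmetric[of a "a + b"] by simp
  also have "((a + b) choose Suc b) + ((a + b) choose b) = (a + b + 1) choose Suc b" by simp
  also have "\<dots> = (a + b + 1) choose a"
    using binomial_symmetric[of "Suc b" "a + b + 1"] by simp
  finally show ?thesis .
qed

lemma reduced_value_Suc:
  "reduced_value a (Suc b) 0 (Suc d) =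
     reduced_value a (Suc b) 0 d + ((a + b + d + 2) choose a) * ((b + d + 1) choose Suc d)"
proof -
  \<comment> \<open>Both sides count the ways to pick \<open>b\<close> and then \<open>d + 1\<close> out of \<open>x + b + d + 1\<close>.\<close>
  have mult: "((x + b) choose b) * ((x + b + 1 + d) choose Suc d)
      = ((b + d + 1) choose Suc d) * ((x + (b + d + 1)) choose (b + d + 1))" for x
    using choose_mult_lemma[of b x "Suc d"] binomial_symmetric[of b "x + b"]
    by (simp add: ac_simps)
  have split: "(x + b + 1 + Suc d) choose Suc d
      = ((x + b + 1 + d) choose d) + ((x + b + 1 + d) choose Suc d)" for x
    by simp
  have sym: "(a + b) choose a = (a + b) choose b"
    using binomial_symmetric[of a "a + b"] by simp
  have "reduced_value a (Suc b) 0 (Suc d) = reduced_value a (Suc b) 0 d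
      + ((\<Sum>i<a. ((i + b) choose b) * ((i + b + 1 + d) choose Suc d))
         + ((a + b) choose b) * ((a + b + 1 + d) choose Suc d))"
    unfolding reduced_value_closed add_0 split distrib_left sum.distrib sym by simp
  also have "(\<Sum>i<a. ((i + b) choose b) * ((i + b + 1 + d) choose Suc d))
      + ((a + b) choose b) * ((a + b + 1 + d) choose Suc d)
      = ((b + d + 1) choose Suc d) * (\<Sum>i<Suc a. (i + (b + d + 1)) choose (b + d + 1))"
    unfolding mult by (simp add: sum_distrib_left distrib_left)
  also have "(\<Sum>i<Suc a. (i + (b + d + 1)) choose (b + d + 1))
      = (a + b + d + 2) choose (b + d + 2)"
    unfolding sum_choose_column by (simp add: ac_simps)
  also have "\<dots> = (a + b + d + 2) choose a"
    using binomial_symmetric[of a "a + b + d + 2"] by simp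
  finally show ?thesis by (simp add: mult.commute)
qed

section \<open>Permutations that rise, fall and rise again\<close>

text \<open>Lists that enumerate \<open>V\<close> and have \<open>n\<close> ascents, then \<open>m\<close> descents, then only ascents.\<close>

definition up_down_up :: "nat \<Rightarrow> nat \<Rightarrow> 'a::linorder set \<Rightarrow> 'a list set" where
  "up_down_up n m V = {xs. distinct xs \<and> set xs = V \<and>
     sorted_wrt (<) (take (Suc n) xs) \<and>
     sorted_wrt (>) (take (Suc m) (drop n xs)) \<and>
     sorted_wrt (<) (drop (n + m) xs)}"

lemma finite_up_down_up: "finite V \<Longrightarrow> finite (up_down_up n m V)"
  by (rule finite_subset[OF _ finite_subset_distinct[of V]]) (auto simp: up_down_up_def)

lemma length_up_down_up: "xs \<in> up_down_up n m V \<Longrightarrow> length xs = card V"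
  by (auto simp: up_down_up_def distinct_card)

lemma maximum_position:
  assumes "xs \<in> up_down_up n (Suc m) V" and "card V = n + m + k + 2" and "finite V"
  shows "xs ! n = Max V \<or> last xs = Max V"
proof -
  have len: "length xs = n + m + k + 2" using length_up_down_up[OF assms(1)] assms(2) by simp
  have "V \<noteq> {}" using assms(2) by auto
  then have "Max V \<in> set xs" using Max_in[OF assms(3)] assms(1) by (auto simp: up_down_up_def)
  then obtain i where i: "i < length xs" "xs ! i = Max V" by (auto simp: in_set_conv_nth)
  have le: "xs ! j \<le> xs ! i" if "j < length xs" for j
    using Max_ge[OF assms(3), of "xs ! j"] that i(2) assms(1) by (auto simp: up_down_up_def)
  consider "i < n" | "i = n" | "n < i" "i \<le> n + Suc m" | "n + Suc m < i" by linarith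
  then show ?thesis
  proof cases
    case 1
    have "xs ! i < xs ! n"
      using assms(1) sorted_wrt_nth_less[of "(<)" "take (Suc n) xs" i n] 1 len
      by (simp add: up_down_up_def)
    then show ?thesis using le[of n] len by simp
  next
    case 2
    then show ?thesis using i by simp
  next
    case 3
    have "xs ! n > xs ! i"
      using assms(1) sorted_wrt_nth_less[of "(>)" "take (Suc (Suc m)) (drop n xs)" 0 "i - n"] 3 len
      by (simp add: up_down_up_def)
    then show ?thesis using le[of n] len by simp
  next
    case 4
    have "\<not> i < length xs - 1"
    proof
      assume "i < length xs - 1"
      then have "xs ! i < xs ! (length xs - 1)"
        using assms(1) sorted_wrt_nth_less[of "(<)" "drop (n + Suc m) xs" "i - (n + Suc m)"
            "length xs - 1 - (n + Suc m)"] 4 len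
        by (simp add: up_down_up_def)
      then show False using le[of "length xs - 1"] len by simp
    qed
    then have "i = length xs - 1" using i(1) by simp
    then show ?thesis using i len by (simp add: last_conv_nth flip: length_0_conv)
  qed
qed

text \<open>If the maximum is at the peak, the values before it form an arbitrary set \<open>Y\<close> and the
  list after it is a valley.\<close>

lemma card_maximum_at_peak:
  fixes V :: "'a::linorder set"
  assumes "finite V" and "card V = n + m + k + 2"
    and "\<And>W :: 'a set. finite W \<Longrightarrow> card W = m + k + 1 \<Longrightarrow> card (up_down_up 0 m W) = c"
  shows "card {xs \<in> up_down_up n (Suc m) V. xs ! n = Max V} = ((n + m + k + 1) choose n) * c"
proof -
  define M where "M = Max V"
  have ne: "V \<noteq> {}" using assms(2) by auto
  have M: "M \<in> V" "\<And>v. v \<in> V - {M} \<Longrightarrow> v < M"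
    using Max_in[OF assms(1) ne] Max_ge[OF assms(1)] by (auto simp: M_def less_le)
  define Ys where "Ys = {Y. Y \<subseteq> V - {M} \<and> card Y = n}"
  define D where "D = (SIGMA Y:Ys. up_down_up 0 m (V - {M} - Y))"
  define f where "f = (\<lambda>(Y, zs). sorted_list_of_set Y @ M # (zs :: 'a list))"
  have finY: "finite Y" if "Y \<in> Ys" for Y
    using that assms(1) by (auto simp: Ys_def intro: finite_subset)
  have split: "as @ M # zs \<in> up_down_up n (Suc m) V \<longleftrightarrow>
      sorted_wrt (<) as \<and> set as \<in> Ys \<and> zs \<in> up_down_up 0 m (V - {M} - set as)"
    if "length as = n" for as zs
  proof -
    have part: "distinct (as @ M # zs) \<and> set (as @ M # zs) = V \<longleftrightarrow>
      distinct as \<and> set as \<subseteq> V - {M} \<and> distinct zs \<and> set zs = V - {M} - set as"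
      using M(1) by auto
    have less: "\<forall>x\<in>set as. x < M" "\<forall>x\<in>set (take (Suc m) zs). M > x"
      if "set as \<subseteq> V - {M}" "set zs = V - {M} - set as"
      using that M(2) set_take_subset[of "Suc m" zs] by blast+
    have lists: "take (Suc n) (as @ M # zs) = as @ [M]"
      "take (Suc (Suc m)) (drop n (as @ M # zs)) = M # take (Suc m) zs"
      "drop (n + Suc m) (as @ M # zs) = drop m zs"
      using that by simp_all
    have prefix: "sorted_wrt (<) as \<Longrightarrow> distinct as"
      by (simp add: strict_sorted_iff)
    have size: "distinct as \<Longrightarrow> card (set as) = n"
      using that by (simp add: distinct_card)
    have left: "as @ M # zs \<in> up_down_up n (Suc m) V \<longleftrightarrow>
        (distinct as \<and> set as \<subseteq> V - {M} \<and> distinct zs \<and> set zs = V - {M} - set as) \<and>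
        (sorted_wrt (<) as \<and> (\<forall>x\<in>set as. x < M)) \<and>
        ((\<forall>x\<in>set (take (Suc m) zs). M > x) \<and> sorted_wrt (>) (take (Suc m) zs)) \<and>
        sorted_wrt (<) (drop m zs)"
      unfolding up_down_up_def mem_Collect_eq lists part[symmetric]
      by (simp add: sorted_wrt_append)
    have right: "zs \<in> up_down_up 0 m (V - {M} - set as) \<longleftrightarrow>
        distinct zs \<and> set zs = V - {M} - set as \<and>
        sorted_wrt (>) (take (Suc m) zs) \<and> sorted_wrt (<) (drop m zs)"
    proof -
      have "sorted_wrt (<) (take (Suc 0) zs)" by (cases zs) simp_all
      then show ?thesis by (simp add: up_down_up_def)
    qed
    have mem: "set as \<in> Ys \<longleftrightarrow> set as \<subseteq> V - {M} \<and> card (set as) = n"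
      by (simp add: Ys_def)
    show ?thesis
      unfolding left right mem using less prefix size by blast
  qed
  have "bij_betw f D {xs \<in> up_down_up n (Suc m) V. xs ! n = M}"
  proof (rule bij_betw_imageI)
    show "inj_on f D"
    proof (rule inj_onI)
      fix p q assume "p \<in> D" "q \<in> D" "f p = f q"
      moreover obtain Y zs Y' zs' where pq: "p = (Y, zs)" "q = (Y', zs')"
        by (cases p, cases q)
      ultimately have Y: "Y \<in> Ys" "Y' \<in> Ys"
        and eq: "sorted_list_of_set Y @ M # zs = sorted_list_of_set Y' @ M # zs'"
        by (auto simp: D_def f_def)
      have "length (sorted_list_of_set Y) = length (sorted_list_of_set Y')"
        using Y by (simp add: Ys_def)
      then have "sorted_list_of_set Y = sorted_list_of_set Y'" "zs = zs'"
        using eq by simp_all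
      then show "p = q"
        using pq finY[OF Y(1)] finY[OF Y(2)] sorted_list_of_set_inject by blast
    qed
    show "f ` D = {xs \<in> up_down_up n (Suc m) V. xs ! n = M}"
    proof (intro equalityI subsetI)
      fix xs assume "xs \<in> f ` D"
      then obtain Y zs where *: "Y \<in> Ys" "zs \<in> up_down_up 0 m (V - {M} - Y)"
        "xs = sorted_list_of_set Y @ M # zs"
        by (auto simp: D_def f_def)
      have len: "length (sorted_list_of_set Y) = n" using *(1) by (simp add: Ys_def)
      show "xs \<in> {xs \<in> up_down_up n (Suc m) V. xs ! n = M}"
        using split[OF len, of zs] * finY[OF *(1)] len by (simp add: nth_append)
    next
      fix xs assume "xs \<in> {xs \<in> up_down_up n (Suc m) V. xs ! n = M}"
      then have xs: "xs \<in> up_down_up n (Suc m) V" "xs ! n = M" by auto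
      then have "length xs > n" using length_up_down_up[OF xs(1)] assms(2) by simp
      then have eq: "xs = take n xs @ M # drop (Suc n) xs" "length (take n xs) = n"
        using xs(2) id_take_nth_drop[of n xs] by auto
      then have *: "sorted_wrt (<) (take n xs)" "set (take n xs) \<in> Ys"
        "drop (Suc n) xs \<in> up_down_up 0 m (V - {M} - set (take n xs))"
        using split[OF eq(2), of "drop (Suc n) xs"] xs(1) by auto
      have "sorted_list_of_set (set (take n xs)) = take n xs"
        using *(1) by (simp add: sorted_list_of_set.idem_if_sorted_distinct strict_sorted_iff)
      then have "xs = f (set (take n xs), drop (Suc n) xs)"
        using eq(1) by (simp add: f_def)
      then show "xs \<in> f ` D" using * by (auto simp: D_def)
    qed
  qed
  then have "card {xs \<in> up_down_up n (Suc m) V. xs ! n = M} = card D"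
    by (simp add: bij_betw_same_card)
  also have "\<dots> = (\<Sum>Y\<in>Ys. card (up_down_up 0 m (V - {M} - Y)))"
    unfolding D_def using assms(1) by (intro card_SigmaI) (auto simp: Ys_def finite_up_down_up)
  also have "\<dots> = (\<Sum>Y\<in>Ys. c)"
  proof (intro sum.cong refl assms(3))
    fix Y assume Y: "Y \<in> Ys"
    show "finite (V - {M} - Y)" using assms(1) by simp
    show "card (V - {M} - Y) = m + k + 1"
      using Y assms(1,2) M(1) finY[OF Y] by (simp add: Ys_def card_Diff_subset)
  qed
  also have "\<dots> = ((n + m + k + 1) choose n) * c"
    using assms(1,2) M(1) n_subsets[of "V - {M}" n] by (simp add: Ys_def)
  finally show ?thesis unfolding M_def .
qed

lemma card_maximum_at_end:
  fixes V :: "'a::linorder set"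
  assumes "finite V" and "card V = n + m + k + 2"
  shows "card {xs \<in> up_down_up n m V. last xs = Max V} = card (up_down_up n m (V - {Max V}))"
proof -
  define M where "M = Max V"
  have ne: "V \<noteq> {}" using assms(2) by auto
  have M: "M \<in> V" "\<And>v. v \<in> V - {M} \<Longrightarrow> v < M"
    using Max_in[OF assms(1) ne] Max_ge[OF assms(1)] by (auto simp: M_def less_le)
  have iff: "ys @ [M] \<in> up_down_up n m V \<longleftrightarrow> ys \<in> up_down_up n m (V - {M})"
    if "length ys = n + m + k + 1" for ys
  proof -
    have "distinct (ys @ [M]) \<and> set (ys @ [M]) = V \<longleftrightarrow> distinct ys \<and> set ys = V - {M}"
      using M(1) by auto
    moreover have "\<forall>x\<in>set (drop (n + m) ys). x < M" if "set ys = V - {M}"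
      using that M(2) set_drop_subset[of "n + m" ys] by blast
    ultimately show ?thesis
      using that by (auto simp: up_down_up_def sorted_wrt_append)
  qed
  have "bij_betw (\<lambda>ys. ys @ [M]) (up_down_up n m (V - {M})) {xs \<in> up_down_up n m V. last xs = M}"
  proof (rule bij_betw_imageI)
    show "(\<lambda>ys. ys @ [M]) ` up_down_up n m (V - {M}) = {xs \<in> up_down_up n m V. last xs = M}"
    proof (intro equalityI subsetI)
      fix xs assume "xs \<in> (\<lambda>ys. ys @ [M]) ` up_down_up n m (V - {M})"
      then obtain ys where ys: "ys \<in> up_down_up n m (V - {M})" "xs = ys @ [M]" by auto
      have "length ys = n + m + k + 1"
        using length_up_down_up[OF ys(1)] assms M(1) by simp
      then show "xs \<in> {xs \<in> up_down_up n m V. last xs = M}" using iff ys by simp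
    next
      fix xs assume "xs \<in> {xs \<in> up_down_up n m V. last xs = M}"
      then have xs: "xs \<in> up_down_up n m V" "last xs = M" by auto
      have len: "length xs = n + m + k + 2" using length_up_down_up[OF xs(1)] assms(2) by simp
      then have "xs \<noteq> []" by auto
      then have eq: "xs = butlast xs @ [M]" using xs(2) append_butlast_last_id[of xs] by simp
      have "butlast xs \<in> up_down_up n m (V - {M})"
        using iff[of "butlast xs"] eq xs(1) len by simp
      then show "xs \<in> (\<lambda>ys. ys @ [M]) ` up_down_up n m (V - {M})" using eq by blast
    qed
  qed (simp add: inj_on_def)
  then show ?thesis unfolding M_def by (simp add: bij_betw_same_card)
qed

lemma card_up_down_up_no_descent:
  assumes "finite V"
  shows "card (up_down_up 0 0 V) = 1"
proof -
  have "sorted_wrt P (take (Suc 0) xs)" for P and xs :: "'a list"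
    by (cases xs) simp_all
  then have "up_down_up 0 0 V = {sorted_list_of_set V}"
    using assms
    by (auto simp: up_down_up_def strict_sorted_iff sorted_list_of_set.idem_if_sorted_distinct)
  then show ?thesis by simp
qed

lemma card_up_down_up_0:
  fixes V :: "'a::linorder set"
  assumes "finite V" and "card V = n + m + 2"
    and "\<And>W :: 'a set. finite W \<Longrightarrow> card W = m + 1 \<Longrightarrow> card (up_down_up 0 m W) = c"
  shows "card (up_down_up n (Suc m) V) = ((n + m + 1) choose n) * c"
proof -
  have "xs ! n = Max V" if xs: "xs \<in> up_down_up n (Suc m) V" for xs
  proof (rule disjE[OF maximum_position[OF xs, of 0]])
    assume last: "last xs = Max V"
    have len: "length xs = n + m + 2" using length_up_down_up[OF xs] assms(2) by simp
    have "xs ! n > xs ! (n + Suc m)"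
      using xs len sorted_wrt_nth_less[of "(>)" "take (Suc (Suc m)) (drop n xs)" 0 "Suc m"]
      by (simp add: up_down_up_def)
    moreover have "xs ! (n + Suc m) = Max V"
      using last len last_conv_nth[of xs] by (cases xs) auto
    moreover have "xs ! n \<le> Max V"
      using xs len nth_mem[of n xs] by (intro Max_ge assms) (auto simp: up_down_up_def)
    ultimately show ?thesis by simp
  qed (use assms in auto)
  then have "up_down_up n (Suc m) V = {xs \<in> up_down_up n (Suc m) V. xs ! n = Max V}" by blast
  then show ?thesis using card_maximum_at_peak[OF assms(1), of n m 0 c] assms by simp
qed

lemma card_up_down_up_Suc:
  fixes V :: "'a::linorder set"
  assumes "finite V" and "card V = n + m + k + 3"
    and "\<And>W :: 'a set. finite W \<Longrightarrow> card W = m + k + 2 \<Longrightarrow> card (up_down_up 0 m W) = c"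
  shows "card (up_down_up n (Suc m) V) =
    card (up_down_up n (Suc m) (V - {Max V})) + ((n + m + k + 2) choose n) * c"
proof -
  let ?U = "up_down_up n (Suc m) V"
  have "?U = {xs \<in> ?U. last xs = Max V} \<union> {xs \<in> ?U. xs ! n = Max V}"
    using maximum_position[of _ n m V "Suc k"] assms by auto
  moreover have "{xs \<in> ?U. last xs = Max V} \<inter> {xs \<in> ?U. xs ! n = Max V} = {}"
  proof -
    have "last xs \<noteq> xs ! n" if xs: "xs \<in> ?U" for xs
    proof -
      have "length xs = n + m + k + 3" "distinct xs"
        using length_up_down_up[OF xs] xs assms(2) by (auto simp: up_down_up_def)
      then show ?thesis
        using nth_eq_iff_index_eq[of xs "length xs - 1" n] last_conv_nth[of xs] by force
    qed
    then show ?thesis by force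
  qed
  ultimately have "card ?U = card {xs \<in> ?U. last xs = Max V} + card {xs \<in> ?U. xs ! n = Max V}"
    using finite_up_down_up[OF assms(1)] card_Un_disjoint[of "{xs \<in> ?U. last xs = Max V}"]
    by (metis (no_types, lifting) finite_Un)
  then show ?thesis
    using card_maximum_at_end[of V n "Suc m" k] card_maximum_at_peak[of V n m "Suc k" c] assms
    by simp
qed

lemma card_valley:
  fixes V :: "'a::linorder set"
  assumes "finite V" and "card V = m + k + 1"
  shows "card (up_down_up 0 m V) = (m + k) choose k"
  using assms
proof (induction m arbitrary: k V)
  case 0
  then show ?case by (simp add: card_up_down_up_no_descent)
next
  case (Suc m)
  note valley_IH = Suc.IH
  from Suc.prems show ?case
  proof (induction k arbitrary: V)
    case 0
    then show ?case
      using card_up_down_up_0[of V 0 m 1] valley_IH[of _ 0] by simp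
  next
    case (Suc k)
    have "V \<noteq> {}" using Suc.prems(2) by auto
    then have "card (V - {Max V}) = Suc m + k + 1" using Suc.prems by simp
    then show ?case
      using card_up_down_up_Suc[of V 0 m k "(m + Suc k) choose Suc k"] valley_IH[of _ "Suc k"]
        Suc.IH[of "V - {Max V}"] Suc.prems by simp
  qed
qed

lemma card_up_down_up:
  fixes V :: "'a::linorder set"
  assumes "finite V" and "card V = n + m + k + 2"
  shows "card (up_down_up n (Suc m) V) = reduced_value n (Suc m) 0 k"
  using assms
proof (induction k arbitrary: V)
  case 0
  then have "card (up_down_up n (Suc m) V) = ((n + m + 1) choose n) * 1"
    by (intro card_up_down_up_0) (simp_all add: card_valley[of _ m 0])
  then show ?case by (simp add: reduced_value_0)
next
  case (Suc k)
  have "V \<noteq> {}" using Suc.prems(2) by auto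
  then have "card (V - {Max V}) = n + m + k + 2" using Suc.prems by simp
  then have "card (up_down_up n (Suc m) (V - {Max V})) = reduced_value n (Suc m) 0 k"
    using Suc.IH Suc.prems(1) by simp
  moreover have "card (up_down_up n (Suc m) V) = card (up_down_up n (Suc m) (V - {Max V}))
      + ((n + m + k + 2) choose n) * ((m + Suc k) choose Suc k)"
    using Suc.prems
    by (intro card_up_down_up_Suc) (simp_all add: card_valley[of _ m "Suc k"] del: binomial_Suc_Suc)
  ultimately show ?case by (simp add: reduced_value_Suc)
qed

section \<open>Permutations as lists\<close>

lemma bij_betw_permutes_lists:
  "bij_betw (\<lambda>\<sigma>. map \<sigma> [1..<Suc N]) {\<sigma>. \<sigma> permutes {1..N}} {xs. distinct xs \<and> set xs = {1..N}}"
proof (rule bij_betw_imageI)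
  have set: "set [1..<Suc N] = {1..N}" by auto
  show "inj_on (\<lambda>\<sigma>. map \<sigma> [1..<Suc N]) {\<sigma>. \<sigma> permutes {1..N}}"
  proof (rule inj_onI)
    fix \<sigma> \<tau> assume *: "\<sigma> \<in> {\<sigma>. \<sigma> permutes {1..N}}" "\<tau> \<in> {\<sigma>. \<sigma> permutes {1..N}}"
      "map \<sigma> [1..<Suc N] = map \<tau> [1..<Suc N]"
    have "\<forall>i\<in>{1..N}. \<sigma> i = \<tau> i" using *(3) unfolding map_eq_conv set .
    moreover have "\<sigma> i = \<tau> i" if "i \<notin> {1..N}" for i
      using *(1,2) that by (simp add: permutes_not_in)
    ultimately show "\<sigma> = \<tau>" by blast
  qed
  show "(\<lambda>\<sigma>. map \<sigma> [1..<Suc N]) ` {\<sigma>. \<sigma> permutes {1..N}} = {xs. distinct xs \<and> set xs = {1..N}}"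
  proof (intro equalityI subsetI)
    fix xs assume "xs \<in> (\<lambda>\<sigma>. map \<sigma> [1..<Suc N]) ` {\<sigma>. \<sigma> permutes {1..N}}"
    then obtain \<sigma> where "\<sigma> permutes {1..N}" and xs: "xs = map \<sigma> [1..<Suc N]" by auto
    then show "xs \<in> {xs. distinct xs \<and> set xs = {1..N}}"
      using permutes_inj_on[of \<sigma> "{1..N}"] permutes_image[of \<sigma> "{1..N}"]
      unfolding mem_Collect_eq xs distinct_map set_map set by simp
  next
    fix xs :: "nat list" assume "xs \<in> {xs. distinct xs \<and> set xs = {1..N}}"
    then have xs: "distinct xs" "set xs = {1..N}" by auto
    then have len: "length xs = N" using distinct_card[OF xs(1)] by simp
    define \<sigma> where "\<sigma> i = (if i \<in> {1..N} then xs ! (i - 1) else i)" for i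
    have map: "map \<sigma> [1..<Suc N] = xs"
      by (rule nth_equalityI) (auto simp: len \<sigma>_def simp del: upt_Suc)
    then have "inj_on \<sigma> {1..N}" "\<sigma> ` {1..N} = {1..N}"
      using xs distinct_map[of \<sigma> "[1..<Suc N]"] set_map[of \<sigma> "[1..<Suc N]"] unfolding set by auto
    then have "\<sigma> permutes {1..N}"
      by (intro bij_imp_permutes) (auto simp: bij_betw_def \<sigma>_def)
    then show "xs \<in> (\<lambda>\<sigma>. map \<sigma> [1..<Suc N]) ` {\<sigma>. \<sigma> permutes {1..N}}"
      using map by (intro image_eqI[of _ _ \<sigma>]) simp_all
  qed
qed

lemma sorted_wrt_map_upt:
  assumes "transp R"
  shows "sorted_wrt R (map \<sigma> [a..<Suc b]) \<longleftrightarrow> (\<forall>i\<in>{a..<b}. R (\<sigma> i) (\<sigma> (i + 1)))"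
proof -
  have "sorted_wrt R (map \<sigma> [a..<Suc b]) \<longleftrightarrow> (\<forall>i. Suc i < Suc b - a \<longrightarrow> R (\<sigma> (a + i)) (\<sigma> (a + Suc i)))"
    by (auto simp: sorted_wrt_iff_nth_Suc_transp[OF assms] simp del: upt_Suc)
  also have "\<dots> \<longleftrightarrow> (\<forall>i\<in>{a..<b}. R (\<sigma> i) (\<sigma> (i + 1)))"
  proof (intro iffI ballI allI impI)
    fix i assume *: "\<forall>i. Suc i < Suc b - a \<longrightarrow> R (\<sigma> (a + i)) (\<sigma> (a + Suc i))" "i \<in> {a..<b}"
    then show "R (\<sigma> i) (\<sigma> (i + 1))" using *(1)[rule_format, of "i - a"] by auto
  qed auto
  finally show ?thesis .
qed

lemma card_up_down_up_permutations:
  "card {\<sigma>. \<sigma> permutes {1..n + m + k + 1} \<and>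
      (\<forall>i\<in>{1..n}. \<sigma> i < \<sigma> (i + 1)) \<and>
      (\<forall>i\<in>{n + 1..n + m}. \<sigma> i > \<sigma> (i + 1)) \<and>
      (\<forall>i\<in>{n + m + 1..n + m + k}. \<sigma> i < \<sigma> (i + 1))}
   = card (up_down_up n m {1..n + m + k + 1})"
    (is "card ?S = _")
proof -
  define N where "N = n + m + k + 1"
  let ?f = "\<lambda>\<sigma> :: nat \<Rightarrow> nat. map \<sigma> [1..<Suc N]"
  have take1: "take (Suc n) (?f \<sigma>) = map \<sigma> [1..<Suc (n + 1)]" for \<sigma>
    by (simp add: take_map take_upt N_def del: upt_Suc)
  have take2: "take (Suc m) (drop n (?f \<sigma>)) = map \<sigma> [n + 1..<Suc (n + m + 1)]" for \<sigma>
    by (simp add: take_map drop_map drop_upt take_upt N_def del: upt_Suc)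
  have drop: "drop (n + m) (?f \<sigma>) = map \<sigma> [n + m + 1..<Suc (n + m + k + 1)]" for \<sigma>
    by (simp add: drop_map drop_upt N_def del: upt_Suc)
  have trans: "transp ((<) :: nat \<Rightarrow> _)" "transp ((>) :: nat \<Rightarrow> _)"
    by (auto simp: transp_def)
  have ivl: "{1..<n + 1} = {1..n}" "{n + 1..<n + m + 1} = {n + 1..n + m}"
    "{n + m + 1..<n + m + k + 1} = {n + m + 1..n + m + k}" by auto
  have "?f \<sigma> \<in> up_down_up n m {1..N} \<longleftrightarrow>
      (\<forall>i\<in>{1..n}. \<sigma> i < \<sigma> (i + 1)) \<and>
      (\<forall>i\<in>{n + 1..n + m}. \<sigma> i > \<sigma> (i + 1)) \<and>
      (\<forall>i\<in>{n + m + 1..n + m + k}. \<sigma> i < \<sigma> (i + 1))"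
    if "\<sigma> permutes {1..N}" for \<sigma>
    using bij_betw_apply[OF bij_betw_permutes_lists[of N], of \<sigma>] that
    unfolding up_down_up_def mem_Collect_eq take1 take2 drop sorted_wrt_map_upt[OF trans(1)]
      sorted_wrt_map_upt[OF trans(2)] ivl by blast
  then have S: "?S = {\<sigma> \<in> {\<sigma>. \<sigma> permutes {1..N}}. ?f \<sigma> \<in> up_down_up n m {1..N}}"
    unfolding N_def[symmetric] by blast
  have "bij_betw ?f {\<sigma> \<in> {\<sigma>. \<sigma> permutes {1..N}}. ?f \<sigma> \<in> up_down_up n m {1..N}}
      (up_down_up n m {1..N})"
  proof (rule bij_betw_subset[OF bij_betw_permutes_lists[of N]])
    show "?f ` {\<sigma> \<in> {\<sigma>. \<sigma> permutes {1..N}}. ?f \<sigma> \<in> up_down_up n m {1..N}}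
        = up_down_up n m {1..N}"
    proof (intro equalityI subsetI)
      fix xs assume xs: "xs \<in> up_down_up n m {1..N}"
      then have "xs \<in> ?f ` {\<sigma>. \<sigma> permutes {1..N}}"
        using bij_betw_imp_surj_on[OF bij_betw_permutes_lists[of N]] by (simp add: up_down_up_def)
      then show "xs \<in> ?f ` {\<sigma> \<in> {\<sigma>. \<sigma> permutes {1..N}}. ?f \<sigma> \<in> up_down_up n m {1..N}}"
        using xs by blast
    qed blast
  qed blast
  then have "card ?S = card (up_down_up n m {1..N})"
    unfolding S by (rule bij_betw_same_card)
  then show ?thesis by (simp only: N_def)
qed

theorem proposition5p10:
  fixes n k :: nat
  assumes "k \<le> n"
  shows "poly (P ((X 1 2 * X 2 3) ^ n * X 3 4 ^ k)) 0 =
    int (card {\<sigma>. \<sigma> permutes {1..2 * n + k + 1} \<and>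
      (\<forall>i\<in>{1..n}. \<sigma> i < \<sigma> (i + 1)) \<and>
      (\<forall>i\<in>{n + 1..2 * n}. \<sigma> i > \<sigma> (i + 1)) \<and>
      (\<forall>i\<in>{2 * n + 1..2 * n + k}. \<sigma> i < \<sigma> (i + 1))})"
proof -
  have "card (up_down_up n n {1..n + n + k + 1}) = reduced_value n n 0 k"
  proof (cases n)
    case 0
    then show ?thesis by (simp add: card_up_down_up_no_descent)
  next
    case (Suc m)
    then show ?thesis using card_up_down_up[of "{1..n + n + k + 1}" n m k] by simp
  qed
  then show ?thesis
    using card_up_down_up_permutations[of n n k] P_initial_monomial[of n k]
    by (simp add: mult_2)
qed

end
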